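(* Let $n$ be a positive integer. Consider the two-division tournament described in the context. Then the maximum possible number of common fixtures (over all admissible draws) is $1$ if $n=1$, and $c(n)=2n^2-3n+4$ if $n\geq 2$. Moreover, if home and away are specified as part of the draw (so that a common fixture additionally requires the same club to be the home team in both divisions), the draws can be chosen to realise this maximum and to be balanced in all three round robins (the round robin of division two, and each of the two round robins of division one).
   Context: There are $2n+2$ clubs labelled $0,1,\ldots,2n+1$. Clubs $0,\ldots,2n-1$ each have one team in division one and one team in division two; clubs $2n$ and $2n+1$ have a team in division two only. A round robin is a tournament in which every pair of teams plays exactly once, organised into rounds in which every team plays exactly one match. Division one is played as a double round robin over rounds $1,\ldots,4n-2$: rounds $1,\ldots,2n-1$ form a single round robin among its $2n$ teams, and for $r=1,\ldots,2n-1$ the matches in round $r+(2n-1)$ are exactly the same as those in round $r$ (with home and away reversed, if home/away is specified). Division two is played as a single round robin among its $2n+2$ teams, in rounds $1,\ldots,2n+1$ (coinciding with the first $2n+1$ rounds of division one). Equivalently: a draw consists of a proper edge colouring $c_1:E(K_{2n})\to\{1,\ldots,2n-1\}$ of the complete graph on $\{0,\ldots,2n-1\}$ and a proper edge colouring $c_2:E(K_{2n+2})\to\{1,\ldots,2n+1\}$ of the complete graph on $\{0,\ldots,2n+1\}$ (the edges of colour $r$ being the matches of round $r$). Two clubs $x,y\in\{0,\ldots,2n-1\}$ have a common fixture if their division-one teams and their division-two teams play each other in the same round, i.e. $c_2(\{x,y\})\equiv c_1(\{x,y\}) \pmod{2n-1}$; when home and away are specified, it is additionally required that the same club is the home team in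 both of these matches. The number of common fixtures is the number of such edges $\{x,y\}$. When home and away are specified (represented by orienting each edge from home team to away team), a round robin draw is balanced if the numbers of home games of any two teams in it differ by at most one. *)

theory Defs
  imports "HOL-Library.Ramsey" "HOL-Number_Theory.Cong"
begin

text \<open>Clubs are the naturals below \<open>2 * n + 2\<close>; matches (edges of a complete graph) are
  two-element sets of clubs, and the colour of an edge is the round in which it is played.\<close>

definition complete_edges :: "nat \<Rightarrow> nat set set" where
  "complete_edges m = [{..<m}]\<^bsup>2\<^esup>"

text \<open>With an even number \<open>m\<close> of teams, properness together with the bound \<open>m - 1\<close> on the number of
  colours forces every team to play exactly one match in each round.\<close>

definition round_robin :: "nat \<Rightarrow> (nat set \<Rightarrow> nat) \<Rightarrow> bool" where
  "round_robin m c \<longleftrightarrow>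
     c ` complete_edges m \<subseteq> {1..m - 1} \<and>
     (\<forall>e \<in> complete_edges m. \<forall>f \<in> complete_edges m. e \<noteq> f \<and> e \<inter> f \<noteq> {} \<longrightarrow> c e \<noteq> c f)"

text \<open>The double round robin of division one is determined by its first half \<open>c1\<close>.\<close>

definition draw :: "nat \<Rightarrow> (nat set \<Rightarrow> nat) \<Rightarrow> (nat set \<Rightarrow> nat) \<Rightarrow> bool" where
  "draw n c1 c2 \<longleftrightarrow> round_robin (2 * n) c1 \<and> round_robin (2 * n + 2) c2"

definition common_fixtures :: "nat \<Rightarrow> (nat set \<Rightarrow> nat) \<Rightarrow> (nat set \<Rightarrow> nat) \<Rightarrow> nat set set" where
  "common_fixtures n c1 c2 = {e \<in> complete_edges (2 * n). [c2 e = c1 e] (mod (2 * n - 1))}"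

text \<open>An orientation contains exactly one of \<open>(x, y)\<close>, \<open>(y, x)\<close> for each match \<open>{x, y}\<close>;
  \<open>(x, y)\<close> means that \<open>x\<close> is the home team.\<close>

definition orientation :: "nat \<Rightarrow> (nat \<times> nat) set \<Rightarrow> bool" where
  "orientation m H \<longleftrightarrow> bij_betw (\<lambda>(x, y). {x, y}) H (complete_edges m)"

definition home_games :: "(nat \<times> nat) set \<Rightarrow> nat \<Rightarrow> nat" where
  "home_games H x = card {y. (x, y) \<in> H}"

definition balanced :: "nat \<Rightarrow> (nat \<times> nat) set \<Rightarrow> bool" where
  "balanced m H \<longleftrightarrow> (\<forall>x < m. \<forall>y < m. home_games H x \<le> home_games H y + 1)"

text \<open>The matches, with home team first, of round \<open>r \<in> {1..4 * n - 2}\<close> of division one; \<open>H1\<close> orients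
  the first half of the double round robin and its converse orients the second half.\<close>

definition div1_round ::
  "nat \<Rightarrow> (nat set \<Rightarrow> nat) \<Rightarrow> (nat \<times> nat) set \<Rightarrow> nat \<Rightarrow> (nat \<times> nat) set" where
  "div1_round n c1 H1 r =
     {(x, y). (x, y) \<in> H1 \<and> c1 {x, y} = r \<or> (x, y) \<in> H1\<inverse> \<and> c1 {x, y} + (2 * n - 1) = r}"

text \<open>The home team is compared with that of the division-one match in the very round in which the
  division-two match takes place.  For \<open>n = 1\<close> and \<open>c2 e = 3\<close> there is no such round of division
  one, and \<open>e\<close> is not counted, although the congruence modulo \<open>2 * n - 1 = 1\<close> holds.\<close>

definition home_common_fixtures ::
  "nat \<Rightarrow> (nat set \<Rightarrow> nat) \<Rightarrow> (nat set \<Rightarrow> nat) \<Rightarrow> (nat \<times> nat) set \<Rightarrow> (nat \<times> nat) set \<Rightarrow> nat set set"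
where
  "home_common_fixtures n c1 c2 H1 H2 =
     {e \<in> common_fixtures n c1 c2.
        \<exists>x y. e = {x, y} \<and> (x, y) \<in> H2 \<and> (x, y) \<in> div1_round n c1 H1 (c2 e)}"

text \<open>The subtraction in \<open>nat\<close> does not truncate, since \<open>2 * n\<^sup>2 \<ge> 3 * n\<close> for \<open>n \<ge> 2\<close>.\<close>

definition claimed_max :: "nat \<Rightarrow> nat" where
  "claimed_max n = (if n = 1 then 1 else 2 * n\<^sup>2 - 3 * n + 4)"

end

theory Submission
  imports Defs
begin

text \<open>Upper bound for \<open>n \<ge> 2\<close>: a common fixture is played in division one in round 1 or 2, or in
  division two in a round \<open>r \<in> {3..2 * n - 1}\<close>.  Rounds 1 and 2 contribute at most \<open>n\<close> matches each.
  In all but at most one of the rounds \<open>r \<in> {3..2 * n - 1}\<close>, club \<open>2 * n\<close> plays one of the first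
  \<open>2 * n\<close> clubs, so that at most \<open>n - 1\<close> matches of that round are played among the latter.

  Construction for \<open>n \<ge> 3\<close>: division one is the cyclic 1-factorization of \<open>K\<^sub>2\<^sub>n\<close>, with the clubs
  below \<open>2 * n - 1\<close> as residues and the club \<open>2 * n - 1\<close> at infinity.  The matches \<open>{x, x + 1}\<close> of
  consecutive residues form a Hamiltonian cycle with one edge in each round.  Division two copies
  round 3 and adds the match of the two new clubs.  It copies every round \<open>r \<ge> 4\<close>
  except for its cycle edge \<open>{r - 2, r - 1}\<close>, whose ends play the clubs \<open>2 * n\<close> and \<open>2 * n + 1\<close>
  instead.  The remaining matches (the division-one rounds 1 and 2, the \<open>2 * n - 4\<close> removed edges and four
  matches of either new club) form a 4-regular graph, to be coloured with \<open>1, 2 * n, 2, 2 * n + 1\<close>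
  such that division-one round 1 gets the colours \<open>1, 2 * n\<close> and round 2 the colours
  \<open>2, 2 * n + 1\<close>.  The removed edges form a path, along which the two pairs of colours
  alternate; this cuts the 4-regular graph into two graphs of degree 2 all of whose cycles are even.

  Home and away: the lower club is at home iff the sum of the two clubs is odd.  This is balanced.
  In division two exactly the matches moved to the rounds \<open>2 * n\<close> and \<open>2 * n + 1\<close> have to be
  reversed; reversing some matches of the new clubs as well restores the balance.\<close>

subsection \<open>Draws and orientations from functions of two clubs\<close>

text \<open>Colourings can thus be given by formulas in two clubs; on edges only the values of
  \<open>g\<close> with \<open>u < v\<close> matter.\<close>

definition edge_fun :: "(nat \<Rightarrow> nat \<Rightarrow> 'a) \<Rightarrow> nat set \<Rightarrow> 'a" where
  "edge_fun g e = g (Min e) (Max e)"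

lemma edge_fun_less: "u < v \<Longrightarrow> edge_fun g {u, v} = g u v"
  by (simp add: edge_fun_def min_def max_def)

lemma complete_edgesE:
  assumes "e \<in> complete_edges k"
  obtains u v where "e = {u, v}" "u < v" "v < k"
proof -
  obtain a b where ab: "e = {a, b}" "a \<noteq> b" "a < k" "b < k"
    using assms by (auto simp: complete_edges_def nsets_def card_2_iff)
  show thesis
  proof (cases "a < b")
    case True
    then show thesis using that ab by blast
  next
    case False
    then show thesis using that[of b a] ab by (simp add: insert_commute)
  qed
qed

lemma complete_edgesI: "x \<noteq> y \<Longrightarrow> x < k \<Longrightarrow> y < k \<Longrightarrow> {x, y} \<in> complete_edges k"
  by (simp add: complete_edges_def nsets_def)

lemma finite_complete_edges: "finite (complete_edges k)"
  by (simp add: complete_edges_def finite_imp_finite_nsets)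

lemma card_complete_edges: "card (complete_edges k) = k choose 2"
  by (simp add: complete_edges_def card_nsets)

lemma round_robin_range:
  "round_robin k c \<Longrightarrow> e \<in> complete_edges k \<Longrightarrow> c e \<in> {1..k - 1}"
  unfolding round_robin_def by blast

lemma round_robin_neq:
  "round_robin k c \<Longrightarrow> e \<in> complete_edges k \<Longrightarrow> f \<in> complete_edges k \<Longrightarrow>
    e \<noteq> f \<Longrightarrow> e \<inter> f \<noteq> {} \<Longrightarrow> c e \<noteq> c f"
  unfolding round_robin_def by blast

text \<open>Two distinct edges that meet span three clubs, so it suffices to check triangles
  \<open>u < v < w\<close>.\<close>

lemma round_robin_edge_fun:
  assumes "\<And>u v. u < v \<Longrightarrow> v < k \<Longrightarrow> g u v \<in> {1..k - 1}"
    and "\<And>u v w. u < v \<Longrightarrow> v < w \<Longrightarrow> w < k \<Longrightarrow> distinct [g u v, g u w, g v w]"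
  shows "round_robin k (edge_fun g)"
  unfolding round_robin_def
proof (intro conjI ballI impI)
  show "edge_fun g ` complete_edges k \<subseteq> {1..k - 1}"
  proof
    fix r assume "r \<in> edge_fun g ` complete_edges k"
    then obtain u v where "r = edge_fun g {u, v}" "u < v" "v < k"
      by (metis imageE complete_edgesE)
    then show "r \<in> {1..k - 1}" using assms(1) by (simp add: edge_fun_less)
  qed
next
  fix e f
  assume e: "e \<in> complete_edges k" and f: "f \<in> complete_edges k" and ef: "e \<noteq> f \<and> e \<inter> f \<noteq> {}"
  obtain a b where ab: "e = {a, b}" "a < b" "b < k" using e by (rule complete_edgesE)
  obtain c d where cd: "f = {c, d}" "c < d" "d < k" using f by (rule complete_edgesE)
  consider "a = c" "b < d" | "a = c" "d < b" | "a = d" | "b = c" | "b = d" "a < c" | "b = d" "c < a"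
    using ef ab(1) cd(1) by force
  then show "edge_fun g e \<noteq> edge_fun g f"
  proof cases
    case 1
    then show ?thesis using assms(2)[of a b d] ab cd by (simp add: edge_fun_less)
  next
    case 2
    then show ?thesis using assms(2)[of a d b] ab cd by (simp add: edge_fun_less)
  next
    case 3
    then show ?thesis using assms(2)[of c d b] ab cd by (simp add: edge_fun_less)
  next
    case 4
    then show ?thesis using assms(2)[of a b d] ab cd by (simp add: edge_fun_less)
  next
    case 5
    then show ?thesis using assms(2)[of a c b] ab cd by (simp add: edge_fun_less)
  next
    case 6
    then show ?thesis using assms(2)[of c a b] ab cd by (simp add: edge_fun_less)
  qed
qed

text \<open>\<open>h\<close> is consulted only with the lower club first, where it tells whether
  that club is at home.\<close>

definition home :: "(nat \<Rightarrow> nat \<Rightarrow> bool) \<Rightarrow> nat \<Rightarrow> nat \<Rightarrow> bool" where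
  "home h x y \<longleftrightarrow> (if x < y then h x y else y < x \<and> \<not> h y x)"

definition orient :: "nat \<Rightarrow> (nat \<Rightarrow> nat \<Rightarrow> bool) \<Rightarrow> (nat \<times> nat) set" where
  "orient k h = {(x, y). x < k \<and> y < k \<and> home h x y}"

lemma orientation_orient: "orientation k (orient k h)"
  unfolding orientation_def bij_betw_def
proof
  show "inj_on (\<lambda>(x, y). {x, y}) (orient k h)"
    by (auto simp: inj_on_def orient_def home_def doubleton_eq_iff split: if_splits)
  show "(\<lambda>(x, y). {x, y}) ` orient k h = complete_edges k"
  proof
    show "(\<lambda>(x, y). {x, y}) ` orient k h \<subseteq> complete_edges k"
      by (auto simp: orient_def home_def intro!: complete_edgesI)
    show "complete_edges k \<subseteq> (\<lambda>(x, y). {x, y}) ` orient k h"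
    proof
      fix e assume "e \<in> complete_edges k"
      then obtain u v where e: "e = {u, v}" "u < v" "v < k" by (rule complete_edgesE)
      show "e \<in> (\<lambda>(x, y). {x, y}) ` orient k h"
      proof (cases "h u v")
        case True
        then have "(u, v) \<in> orient k h" using e by (simp add: orient_def home_def)
        then show ?thesis using e by (intro rev_image_eqI) auto
      next
        case False
        then have "(v, u) \<in> orient k h" using e by (simp add: orient_def home_def)
        then show ?thesis using e by (intro rev_image_eqI) auto
      qed
    qed
  qed
qed

lemma home_games_orient:
  "x < k \<Longrightarrow> home_games (orient k h) x = card {y. y < k \<and> home h x y}"
  by (simp add: home_games_def orient_def)

text \<open>The second half of division one is oriented by the converse, so a match that division
  two plays \<open>2 * n - 1\<close> rounds later must swap its home side.\<close>

lemma home_common_fixtures_orient: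
  assumes uv: "u < v" "v < 2 * n"
    and g: "g1 u v \<in> {1..2 * n - 1}"
      "g2 u v = g1 u v \<and> h2 u v = h1 u v \<or> g2 u v = g1 u v + (2 * n - 1) \<and> h2 u v \<noteq> h1 u v"
  shows "{u, v} \<in> home_common_fixtures n (edge_fun g1) (edge_fun g2) (orient (2 * n) h1)
    (orient (2 * n + 2) h2)"
proof -
  have c: "edge_fun g1 {u, v} = g1 u v" "edge_fun g2 {u, v} = g2 u v"
    "edge_fun g1 {v, u} = g1 u v" "edge_fun g2 {v, u} = g2 u v"
    using uv(1) by (simp_all add: edge_fun_less insert_commute)
  have 1: "{u, v} \<in> complete_edges (2 * n)" using uv by (intro complete_edgesI) auto
  have 2: "[g2 u v = g1 u v] (mod (2 * n - 1))"
    using g(2) by (auto simp: cong_def)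
  have 3: "\<exists>x y. {u, v} = {x, y} \<and> (x, y) \<in> orient (2 * n + 2) h2 \<and>
      (x, y) \<in> div1_round n (edge_fun g1) (orient (2 * n) h1) (g2 u v)"
  proof (cases "h2 u v")
    case True
    then have "(u, v) \<in> orient (2 * n + 2) h2 \<and>
        (u, v) \<in> div1_round n (edge_fun g1) (orient (2 * n) h1) (g2 u v)"
      using uv g(2) by (auto simp: div1_round_def orient_def home_def c)
    then show ?thesis by blast
  next
    case False
    then have "(v, u) \<in> orient (2 * n + 2) h2 \<and>
        (v, u) \<in> div1_round n (edge_fun g1) (orient (2 * n) h1) (g2 u v)"
      using uv g(2) by (auto simp: div1_round_def orient_def home_def c)
    then show ?thesis by blast
  qed
  show ?thesis
    using 1 2 3 by (simp add: home_common_fixtures_def common_fixtures_def c)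
qed

lemma home_common_fixtures_subset:
  "home_common_fixtures n c1 c2 H1 H2 \<subseteq> common_fixtures n c1 c2"
  by (auto simp: home_common_fixtures_def)

subsection \<open>Balanced orientations\<close>

definition parity :: "nat \<Rightarrow> nat \<Rightarrow> bool" where
  "parity u v \<longleftrightarrow> odd (u + v)"

text \<open>\<open>R\<close> consists of ordered pairs so that its images count home games lost and
  gained, but the order is ignored when selecting the matches to reverse.\<close>

definition reverse :: "(nat \<times> nat) set \<Rightarrow> (nat \<Rightarrow> nat \<Rightarrow> bool) \<Rightarrow> nat \<Rightarrow> nat \<Rightarrow> bool" where
  "reverse R h u v \<longleftrightarrow> (h u v \<longleftrightarrow> (u, v) \<notin> R \<and> (v, u) \<notin> R)"

text \<open>Split the clubs into pairs \<open>{2 * k, 2 * k + 1}\<close>. Every club hosts exactly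
  one club of each foreign pair; within a pair the even club hosts the odd one.\<close>

lemma home_games_parity:
  assumes x: "x < 2 * j"
  shows "home_games (orient (2 * j) parity) x = (if even x then j else j - 1)"
proof (cases "even x")
  case True
  have "{y. y < 2 * j \<and> home parity x y} = (\<lambda>k. if 2 * k < x then 2 * k else 2 * k + 1) ` {..<j}"
  proof (intro equalityI subsetI)
    fix y assume "y \<in> {y. y < 2 * j \<and> home parity x y}"
    then have "y div 2 < j" "y = (if 2 * (y div 2) < x then 2 * (y div 2) else 2 * (y div 2) + 1)"
      using True unfolding home_def parity_def by (auto split: if_splits elim!: evenE oddE)
    then show "y \<in> (\<lambda>k. if 2 * k < x then 2 * k else 2 * k + 1) ` {..<j}" by blast
  next
    fix y assume "y \<in> (\<lambda>k. if 2 * k < x then 2 * k else 2 * k + 1) ` {..<j}"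
    then show "y \<in> {y. y < 2 * j \<and> home parity x y}"
      using True unfolding home_def parity_def by (auto split: if_splits)
  qed
  moreover have "inj_on (\<lambda>k. if 2 * k < x then 2 * k else 2 * k + 1) {..<j}"
    by (rule inj_onI) (auto split: if_splits)
  ultimately have "card {y. y < 2 * j \<and> home parity x y} = j"
    by (simp only: card_image card_lessThan)
  then show ?thesis using x True by (simp add: home_games_orient)
next
  case False
  have "{y. y < 2 * j \<and> home parity x y} =
    (\<lambda>k. if 2 * k + 1 < x then 2 * k + 1 else 2 * k) ` ({..<j} - {x div 2})"
  proof (intro equalityI subsetI)
    fix y assume "y \<in> {y. y < 2 * j \<and> home parity x y}"
    then have "y div 2 < j" "y div 2 \<noteq> x div 2"
      "y = (if 2 * (y div 2) + 1 < x then 2 * (y div 2) + 1 else 2 * (y div 2))"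
      using False unfolding home_def parity_def by (auto split: if_splits elim!: evenE oddE)
    then show "y \<in> (\<lambda>k. if 2 * k + 1 < x then 2 * k + 1 else 2 * k) ` ({..<j} - {x div 2})"
      by blast
  next
    fix y assume "y \<in> (\<lambda>k. if 2 * k + 1 < x then 2 * k + 1 else 2 * k) ` ({..<j} - {x div 2})"
    then show "y \<in> {y. y < 2 * j \<and> home parity x y}"
      using False unfolding home_def parity_def by (auto split: if_splits elim!: oddE)
  qed
  moreover have "inj_on (\<lambda>k. if 2 * k + 1 < x then 2 * k + 1 else 2 * k) ({..<j} - {x div 2})"
    by (rule inj_onI) (auto split: if_splits)
  moreover have "x div 2 \<in> {..<j}" using x by auto
  ultimately have "card {y. y < 2 * j \<and> home parity x y} = j - 1"
    by (simp only: card_image) simp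
  then show ?thesis using x False by (simp add: home_games_orient)
qed

text \<open>Club \<open>x\<close> loses the home games in \<open>R\<close> that start at
  \<open>x\<close> and gains those that end there. The additive form avoids subtraction on
  \<open>nat\<close>.\<close>

lemma home_games_reverse:
  assumes R: "R \<subseteq> orient k h" and x: "x < k"
  shows "home_games (orient k (reverse R h)) x + card (R `` {x}) =
    home_games (orient k h) x + card (R\<inverse> `` {x})"
proof -
  let ?O = "{y. y < k \<and> home h x y}"
  have out: "R `` {x} \<subseteq> ?O" using R by (auto simp: orient_def)
  have inn: "?O \<inter> R\<inverse> `` {x} = {}" "R\<inverse> `` {x} \<subseteq> {..<k}"
    using R by (auto simp: orient_def home_def split: if_splits)
  have fin: "finite (R\<inverse> `` {x})" using inn(2) finite_subset by blast
  have "{y. y < k \<and> home (reverse R h) x y} = (?O - R `` {x}) \<union> R\<inverse> `` {x}"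
    using R x by (auto simp: orient_def home_def reverse_def split: if_splits)
  moreover have "card ((?O - R `` {x}) \<union> R\<inverse> `` {x}) = card (?O - R `` {x}) + card (R\<inverse> `` {x})"
    using inn fin by (intro card_Un_disjoint) auto
  moreover have "card (?O - R `` {x}) + card (R `` {x}) = card ?O"
  proof -
    have "finite ?O" by simp
    then show ?thesis using out card_mono[of ?O "R `` {x}"]
      by (simp add: card_Diff_subset finite_subset)
  qed
  ultimately show ?thesis using x by (simp add: home_games_orient)
qed

text \<open>Each club plays \<open>k - 1\<close> matches, so its home games in the two orientations
  add up to \<open>k - 1\<close>, and differences between clubs only change sign.\<close>

lemma balanced_converse:
  assumes "balanced k (orient k h)"
  shows "balanced k ((orient k h)\<inverse>)"
proof -
  have *: "home_games ((orient k h)\<inverse>) x + home_games (orient k h) x + 1 = k" if x: "x < k" for x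
  proof -
    have "home_games ((orient k h)\<inverse>) x = card {y. y < k \<and> home h y x}"
      using x by (simp add: home_games_def orient_def)
    moreover have "{..<k} = insert x ({y. y < k \<and> home h y x} \<union> {y. y < k \<and> home h x y})"
      using x by (auto simp: home_def)
    then have "card {..<k} = card (insert x ({y. y < k \<and> home h y x} \<union> {y. y < k \<and> home h x y}))"
      by (rule arg_cong)
    then have "k = Suc (card ({y. y < k \<and> home h y x} \<union> {y. y < k \<and> home h x y}))"
      by (subst (asm) card_insert_disjoint) (auto simp: home_def)
    moreover have "card ({y. y < k \<and> home h y x} \<union> {y. y < k \<and> home h x y}) =
        card {y. y < k \<and> home h y x} + card {y. y < k \<and> home h x y}"
      by (intro card_Un_disjoint) (auto simp: home_def split: if_splits)
    ultimately show ?thesis using x by (simp add: home_games_orient)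
  qed
  have "home_games ((orient k h)\<inverse>) x \<le> home_games ((orient k h)\<inverse>) y + 1" if "x < k" "y < k" for x y
  proof -
    have "home_games (orient k h) y \<le> home_games (orient k h) x + 1"
      using assms that by (simp add: balanced_def)
    then show ?thesis using *[OF that(1)] *[OF that(2)] by linarith
  qed
  then show ?thesis by (simp add: balanced_def)
qed

text \<open>Even clubs start with \<open>j\<close> home games and may lose one on balance, odd clubs
  start with \<open>j - 1\<close> and may gain one; all counts stay in
  \<open>{j - 1, j}\<close>.\<close>

lemma balanced_reverse_parity:
  assumes R: "R \<subseteq> orient (2 * j) parity"
    and "\<And>x. even x \<Longrightarrow> card (R\<inverse> `` {x}) \<le> card (R `` {x}) \<and> card (R `` {x}) \<le> card (R\<inverse> `` {x}) + 1"
    and "\<And>x. odd x \<Longrightarrow> card (R `` {x}) \<le> card (R\<inverse> `` {x}) \<and> card (R\<inverse> `` {x}) \<le> card (R `` {x}) + 1"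
  shows "balanced (2 * j) (orient (2 * j) (reverse R parity))"
proof -
  have "home_games (orient (2 * j) (reverse R parity)) x \<in> {j - 1, j}" if "x < 2 * j" for x
    using home_games_reverse[OF R that] home_games_parity[OF that] assms(2,3)[of x] that
    by (cases "even x") (auto; linarith)+
  then have *: "j - 1 \<le> home_games (orient (2 * j) (reverse R parity)) x \<and>
      home_games (orient (2 * j) (reverse R parity)) x \<le> j" if "x < 2 * j" for x
    using that by fastforce
  show ?thesis unfolding balanced_def
  proof (intro allI impI)
    fix x y assume "x < 2 * j" "y < 2 * j"
    then show "home_games (orient (2 * j) (reverse R parity)) x
        \<le> home_games (orient (2 * j) (reverse R parity)) y + 1"
      using *[of x] *[of y] by linarith
  qed
qed

lemma balanced_parity: "balanced (2 * j) (orient (2 * j) parity)"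
  using home_games_parity[of _ j] unfolding balanced_def by auto

subsection \<open>The upper bound\<close>

lemma matching_card:
  assumes fin: "finite V" and M: "\<And>e. e \<in> M \<Longrightarrow> e \<subseteq> V \<and> card e = 2"
    and disj: "\<And>e f. e \<in> M \<Longrightarrow> f \<in> M \<Longrightarrow> e \<noteq> f \<Longrightarrow> e \<inter> f = {}"
  shows "2 * card M \<le> card V"
proof -
  have "finite M" using fin M by (meson PowI finite_Pow_iff finite_subset subsetI)
  have "card (\<Union>M) = (\<Sum>e\<in>M. card e)"
    using M disj fin by (intro card_Union_disjoint) (auto simp: pairwise_def disjnt_def intro: finite_subset)
  also have "\<dots> = 2 * card M" using M by simp
  finally show ?thesis using M fin by (metis card_mono Sup_least)
qed

text \<open>A colour class is a matching. \<open>V\<close> is kept general because the upper bound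
  needs the clubs of division one both with and without one of them.\<close>

lemma colour_class_card:
  assumes rr: "round_robin k c" and V: "V \<subseteq> {..<k}"
  shows "2 * card {e \<in> [V]\<^bsup>2\<^esup>. c e = r} \<le> card V"
proof (rule matching_card)
  show "finite V" using V finite_subset by blast
  show "e \<subseteq> V \<and> card e = 2" if "e \<in> {e \<in> [V]\<^bsup>2\<^esup>. c e = r}" for e
    using that by (auto simp: nsets_def)
  have "[V]\<^bsup>2\<^esup> \<subseteq> complete_edges k" using V unfolding complete_edges_def by (rule nsets_mono)
  then show "e \<inter> f = {}" if "e \<in> {e \<in> [V]\<^bsup>2\<^esup>. c e = r}" "f \<in> {e \<in> [V]\<^bsup>2\<^esup>. c e = r}" "e \<noteq> f" for e f
    using that round_robin_neq[OF rr, of e f] by auto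
qed

text \<open>The \<open>k - 1\<close> matches of \<open>a\<close> have distinct colours out of
  \<open>k - 1\<close>, so every colour occurs.\<close>

lemma round_robin_plays:
  assumes rr: "round_robin k c" and a: "a < k" and r: "r \<in> {1..k - 1}"
  obtains x where "x < k" "x \<noteq> a" "c {a, x} = r"
proof -
  let ?X = "{..<k} - {a}"
  have sub: "(\<lambda>x. c {a, x}) ` ?X \<subseteq> {1..k - 1}"
    using a by (intro image_subsetI round_robin_range[OF rr] complete_edgesI) auto
  have "inj_on (\<lambda>x. c {a, x}) ?X"
  proof (rule inj_onI, rule ccontr)
    fix x y assume xy: "x \<in> ?X" "y \<in> ?X" "c {a, x} = c {a, y}" "x \<noteq> y"
    then have "{a, x} \<in> complete_edges k" "{a, y} \<in> complete_edges k"
      "{a, x} \<noteq> {a, y}" "{a, x} \<inter> {a, y} \<noteq> {}"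
      using a by (auto intro!: complete_edgesI simp: doubleton_eq_iff)
    then show False using round_robin_neq[OF rr] xy(3) by blast
  qed
  then have "card ((\<lambda>x. c {a, x}) ` ?X) = card {1..k - 1}"
    using a by (simp add: card_image)
  then have "(\<lambda>x. c {a, x}) ` ?X = {1..k - 1}" using sub by (intro card_subset_eq) auto
  then have "r \<in> (\<lambda>x. c {a, x}) ` ?X" using r by simp
  then show thesis using that by auto
qed

lemma common_fixtures_le:
  assumes n: "n \<ge> 2" and d: "draw n c1 c2"
  shows "card (common_fixtures n c1 c2) \<le> 2 * n\<^sup>2 - 3 * n + 4"
proof -
  let ?E = "complete_edges (2 * n)"
  define A where "A r = {e \<in> ?E. c1 e = r}" for r
  define B where "B r = {e \<in> ?E. c2 e = r}" for r
  have r1: "round_robin (2 * n) c1" and r2: "round_robin (2 * n + 2) c2"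
    using d by (auto simp: draw_def)
  have fin: "finite (A r)" "finite (B r)" for r
    by (simp_all add: A_def B_def finite_complete_edges)
  have A: "card (A r) \<le> n" for r
    using colour_class_card[OF r1, of "{..<2 * n}" r] by (simp add: A_def complete_edges_def)
  have B0: "card (B r) \<le> n" for r
    using colour_class_card[OF r2, of "{..<2 * n}" r] by (simp add: B_def complete_edges_def)
  \<comment> \<open>The opponent \<open>x\<close> of club \<open>2 * n\<close> is busy, which leaves
    an odd number of clubs, \<open>2 * n - 1\<close>, and hence at most \<open>n - 1\<close>
    matches.\<close>
  have B1: "card (B r) \<le> n - 1" if r: "r \<in> {3..2 * n - 1}" and ne: "r \<noteq> c2 {2 * n, 2 * n + 1}" for r
  proof -
    obtain x where x: "x < 2 * n + 2" "x \<noteq> 2 * n" "c2 {2 * n, x} = r"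
      by (rule round_robin_plays[OF r2, of "2 * n" r]) (use r in auto)
    have xl: "x < 2 * n" using x ne by (cases "x = 2 * n + 1") auto
    let ?M = "{e \<in> [{..<2 * n} - {x}]\<^bsup>2\<^esup>. c2 e = r}"
    have "B r \<subseteq> ?M"
    proof
      fix e assume e: "e \<in> B r"
      then have e1: "e \<subseteq> {..<2 * n}" "card e = 2" "finite e" "c2 e = r"
        by (auto simp: B_def complete_edges_def nsets_def)
      have "x \<notin> e"
      proof
        assume "x \<in> e"
        moreover have "e \<noteq> {2 * n, x}" using e1 by auto
        moreover have "e \<in> complete_edges (2 * n + 2)"
          using e1 by (auto simp: complete_edges_def nsets_def)
        moreover have "{2 * n, x} \<in> complete_edges (2 * n + 2)"
          using xl by (intro complete_edgesI) auto
        ultimately show False using round_robin_neq[OF r2] e1(4) x(3) by blast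
      qed
      then show "e \<in> ?M"
        using e1 by (auto simp: nsets_def)
    qed
    moreover have "finite ?M"
      by (simp add: finite_imp_finite_nsets)
    ultimately have "card (B r) \<le> card ?M" by (rule card_mono[rotated])
    moreover have "2 * card ?M \<le> card ({..<2 * n} - {x})"
      by (rule colour_class_card[OF r2]) auto
    ultimately show ?thesis using xl by simp
  qed
  let ?p = "c2 {2 * n, 2 * n + 1}"
  have sub: "common_fixtures n c1 c2 \<subseteq> A 1 \<union> A 2 \<union> (\<Union>r\<in>{3..2 * n - 1}. B r)"
  proof
    fix e assume "e \<in> common_fixtures n c1 c2"
    then have e: "e \<in> ?E" and cg: "c2 e mod (2 * n - 1) = c1 e mod (2 * n - 1)"
      by (auto simp: common_fixtures_def cong_def)
    have "e \<in> complete_edges (2 * n + 2)" using e by (auto simp: complete_edges_def nsets_def)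
    then have b2: "1 \<le> c2 e" "c2 e \<le> 2 * n + 1" using round_robin_range[OF r2, of e] by auto
    have b1: "1 \<le> c1 e" "c1 e \<le> 2 * n - 1" using round_robin_range[OF r1 e] by auto
    show "e \<in> A 1 \<union> A 2 \<union> (\<Union>r\<in>{3..2 * n - 1}. B r)"
    proof (cases "c2 e \<in> {3..2 * n - 1}")
      case True
      then show ?thesis using e by (auto simp: B_def)
    next
      case False
      \<comment> \<open>The remaining colours \<open>1\<close>, \<open>2\<close>,
        \<open>2 * n\<close>, \<open>2 * n + 1\<close> are congruent to 1 or 2 modulo
        \<open>2 * n - 1\<close>.\<close>
      then consider "c2 e = 1 \<or> c2 e = 1 + (2 * n - 1)" | "c2 e = 2 \<or> c2 e = 2 + (2 * n - 1)"
        using b2 by fastforce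
      then show ?thesis
      proof cases
        case 1
        then have "c1 e mod (2 * n - 1) = 1 mod (2 * n - 1)" using cg by (metis mod_add_self2)
        \<comment> \<open>Only the colour \<open>2 * n - 1\<close> differs from its residue, which
          is 0.\<close>
        then have "c1 e = 1" using b1 n by (cases "c1 e = 2 * n - 1") auto
        then show ?thesis using e by (simp add: A_def)
      next
        case 2
        then have "c1 e mod (2 * n - 1) = 2 mod (2 * n - 1)" using cg by (metis mod_add_self2)
        then have "c1 e = 2" using b1 n by (cases "c1 e = 2 * n - 1") auto
        then show ?thesis using e by (simp add: A_def)
      qed
    qed
  qed
  have "card (common_fixtures n c1 c2) \<le> card (A 1 \<union> A 2 \<union> (\<Union>r\<in>{3..2 * n - 1}. B r))"
    using sub by (rule card_mono[rotated]) (auto simp: fin)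
  also have "\<dots> \<le> card (A 1) + card (A 2) + card (\<Union>r\<in>{3..2 * n - 1}. B r)"
    by (meson add_mono card_Un_le le_trans order_refl)
  also have "\<dots> \<le> n + n + (\<Sum>r\<in>{3..2 * n - 1}. card (B r))"
    by (intro add_mono A card_UN_le) auto
  \<comment> \<open>The extra 1 pays for the round \<open>?p\<close> in which the two new clubs meet
    each other.\<close>
  also have "(\<Sum>r\<in>{3..2 * n - 1}. card (B r)) \<le> (\<Sum>r\<in>{3..2 * n - 1}. (n - 1) + (if r = ?p then 1 else 0))"
    using B0 B1 n by (intro sum_mono) (auto simp: le_diff_conv)
  also have "\<dots> \<le> (2 * n - 3) * (n - 1) + 1"
    by (simp add: sum.distrib numeral_3_eq_3)
  finally have "card (common_fixtures n c1 c2) \<le> n + n + ((2 * n - 3) * (n - 1) + 1)"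
    by simp
  also obtain k where "n = k + 2" using n by (metis add.commute le_Suc_ex)
  then have "n + n + ((2 * n - 3) * (n - 1) + 1) = 2 * n\<^sup>2 - 3 * n + 4"
    by (simp add: power2_eq_square algebra_simps)
  finally show ?thesis .
qed

lemma common_fixtures_le_claimed_max:
  assumes "n \<ge> 1" "draw n c1 c2"
  shows "card (common_fixtures n c1 c2) \<le> claimed_max n"
proof (cases "n = 1")
  case True
  \<comment> \<open>For \<open>n = 1\<close> the first half of division one is a single
    match.\<close>
  have "card (common_fixtures n c1 c2) \<le> card (complete_edges (2 * n))"
    by (intro card_mono finite_complete_edges) (auto simp: common_fixtures_def)
  then show ?thesis using True by (simp add: card_complete_edges claimed_max_def)
next
  case False
  then show ?thesis using assms common_fixtures_le[of n c1 c2] by (simp add: claimed_max_def)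
qed

subsection \<open>The round robins for \<open>n \<ge> 3\<close>\<close>

text \<open>Modulo \<open>2 * n - 1\<close>, the round \<open>r\<close> is the solution of \<open>2 * (r - 1) = t\<close>; the match of \<open>u\<close> and
  the club at infinity takes the place of the missing \<open>{u, u}\<close>.\<close>

definition div1_colour :: "nat \<Rightarrow> nat \<Rightarrow> nat \<Rightarrow> nat" where
  "div1_colour n u v = (let t = (if v = 2 * n - 1 then 2 * u + 1 else u + v + 1) in
     if even t then t div 2 + 1
     else if t < 2 * n - 1 then (t + (2 * n - 1)) div 2 + 1 else (t - (2 * n - 1)) div 2 + 1)"

text \<open>Only meant for \<open>u < v\<close>.\<close>

definition div2_colour :: "nat \<Rightarrow> nat \<Rightarrow> nat \<Rightarrow> nat" where
  "div2_colour n u v =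
    (if v = 2 * n + 1 then
       (if u = 0 then 2 else if u = 1 then 1 else if u = 2 then 2 * n
        else if u = 2 * n - 1 then 2 * n + 1 else if u = 2 * n then 3 else u + 1)
     else if v = 2 * n then
       (if u = 0 then 1 else if u = 1 then 2 else if u = 2 * n - 2 then 2 * n + 1
        else if u = 2 * n - 1 then 2 * n else u + 2)
     else if v = u + 1 \<and> 2 \<le> u \<and> v \<le> 2 * n - 2 then
       (if even u then 2 * n + 1 else if u = 2 * n - 3 then 1 else 2 * n)
     else if (u, v) = (0, 2 * n - 2) \<or> (u, v) = (1, 2 * n - 3) then 2 * n
     else if (u, v) = (0, 1) then 2 * n + 1
     else div1_colour n u v)"

lemma div1_colour_bounds:
  assumes "u < v" "v < 2 * n"
  shows "1 \<le> div1_colour n u v" "div1_colour n u v < 2 * n"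
  using assms unfolding div1_colour_def Let_def by (auto elim!: evenE oddE)

text \<open>Division and truncated subtraction are traded for linear equations, so that colours can
  be compared by linear arithmetic.\<close>

lemma div1_colour_eq:
  assumes "u < v" "v < 2 * n" and "r = div1_colour n u v"
  shows "v + 1 = 2 * n \<and> (r = u + n + 1 \<or> r + n = u + 2) \<or>
    v + 1 < 2 * n \<and> (2 * r = u + v + 3 \<or> 2 * r = u + v + 2 * n + 2 \<or> 2 * r + 2 * n = u + v + 4)"
proof (cases "v + 1 = 2 * n")
  case True
  then have v: "v = 2 * n - 1" and d: "(2 * u + 1 + (2 * n - 1)) div 2 = u + n"
    "(2 * u + 1 - (2 * n - 1)) div 2 = u + 1 - n" using assms(1) by presburger+
  have "r = (if 2 * u + 1 < 2 * n - 1 then u + n else u + 1 - n) + 1"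
    using assms(3) d unfolding div1_colour_def Let_def v by simp
  then show ?thesis using True assms(1) by (auto split: if_splits)
next
  case False
  then have v: "v + 1 < 2 * n" "v \<noteq> 2 * n - 1" using assms(2) by auto
  show ?thesis
  proof (cases "even (u + v + 1)")
    case True
    then have "2 * r = u + v + 3" using v(2) assms(3) by (simp add: div1_colour_def)
    then show ?thesis using v by blast
  next
    case False
    then have "even (u + v + 1 + (2 * n - 1))" "even (u + v + 1 - (2 * n - 1))"
      using v by auto
    then have "2 * r = (if u + v + 1 < 2 * n - 1 then u + v + 1 + (2 * n - 1) else u + v + 1 - (2 * n - 1)) + 2"
      using False v(2) assms(3) by (simp add: div1_colour_def)
    then show ?thesis using v by (auto split: if_splits)
  qed
qed

text \<open>As 2 is invertible modulo the odd number \<open>2 * n - 1\<close>, equal colours at a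
  common club would force two distinct residues to agree.\<close>

lemma div1_colour_distinct:
  assumes l: "u < v" "v < w" "w < 2 * n"
  shows "distinct [div1_colour n u v, div1_colour n u w, div1_colour n v w]"
proof -
  obtain a b c where eq: "a = div1_colour n u v" "b = div1_colour n u w" "c = div1_colour n v w"
    by blast
  have l': "u < w" "v < 2 * n" using l by auto
  have bd: "1 \<le> a" "a < 2 * n" "1 \<le> b" "b < 2 * n" "1 \<le> c" "c < 2 * n"
    using l l' div1_colour_bounds by (auto simp: eq)
  note e = div1_colour_eq[OF l(1) l'(2) eq(1)] div1_colour_eq[OF l'(1) l(3) eq(2)]
    div1_colour_eq[OF l(2,3) eq(3)]
  have "a \<noteq> b"
  proof
    assume "a = b"
    with e(1,2) bd l l' show False by (elim disjE conjE; (elim disjE)?; (linarith | presburger))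
  qed
  moreover have "a \<noteq> c"
  proof
    assume "a = c"
    with e(1,3) bd l l' show False by (elim disjE conjE; (elim disjE)?; (linarith | presburger))
  qed
  moreover have "b \<noteq> c"
  proof
    assume "b = c"
    with e(2,3) bd l l' show False by (elim disjE conjE; (elim disjE)?; (linarith | presburger))
  qed
  ultimately show ?thesis by (simp add: eq)
qed

text \<open>Cases 1 to 3 are the removed path edges, 4 and 5 the matches moved from round 1 to
  \<open>2 * n\<close>, 6 the match moved from round 2 to \<open>2 * n + 1\<close>, and 7 and 8 the
  matches left in their round. The witness \<open>k\<close> records parity for linear
  arithmetic.\<close>

lemma div2_colour_cases:
  assumes uv: "u < v" "v < 2 * n" "3 \<le> n" and r: "r = div2_colour n u v"
  obtains (1) "v = u + 1" "u + 3 = 2 * n" "r = 1"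
    | (2) k where "v = u + 1" "2 \<le> u" "u = 2 * k + 1" "u + 3 < 2 * n" "r = 2 * n"
    | (3) k where "v = u + 1" "2 \<le> u" "u = 2 * k" "u + 3 < 2 * n" "r = 2 * n + 1"
    | (4) "u = 0" "v + 2 = 2 * n" "r = 2 * n"
    | (5) "u = 1" "v + 3 = 2 * n" "r = 2 * n"
    | (6) "u = 0" "v = 1" "r = 2 * n + 1"
    | (7) "v + 1 = 2 * n" "1 \<le> r" "r < 2 * n" "r = u + n + 1 \<or> r + n = u + 2"
    | (8) "v + 1 < 2 * n" "1 \<le> r" "r < 2 * n" "\<not> (v = u + 1 \<and> 2 \<le> u)" "\<not> (u = 0 \<and> v = 1)"
      "\<not> (u = 0 \<and> v + 2 = 2 * n)" "\<not> (u = 1 \<and> v + 3 = 2 * n)"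
      "2 * r = u + v + 3 \<or> 2 * r = u + v + 2 * n + 2 \<or> 2 * r + 2 * n = u + v + 4"
proof -
  obtain m where n: "n = m + 3" using uv(3) by (metis add.commute le_Suc_ex)
  consider (special) "v = u + 1" "2 \<le> u" "v + 2 \<le> 2 * n"
    | (a) "u = 0" "v + 2 = 2 * n" | (a') "u = 1" "v + 3 = 2 * n" | (b) "u = 0" "v = 1"
    | (reg) "v + 1 = 2 * n \<or> \<not> (v = u + 1 \<and> 2 \<le> u)" "\<not> (u = 0 \<and> v = 1)"
      "\<not> (u = 0 \<and> v + 2 = 2 * n)" "\<not> (u = 1 \<and> v + 3 = 2 * n)"
    using uv by linarith
  then show thesis
  proof cases
    case special
    then have "v \<noteq> 2 * n + 1" "v \<noteq> 2 * n" "v \<le> 2 * n - 2" by linarith+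
    then have "r = (if even u then 2 * n + 1 else if u = 2 * n - 3 then 1 else 2 * n)"
      using special(1,2) r by (simp add: div2_colour_def)
    \<comment> \<open>The last path edge starts at an odd club, so case 3 never meets it.\<close>
    moreover have "u + 3 = 2 * n \<Longrightarrow> odd u" by presburger
    moreover have "u + 3 = 2 * n \<or> u + 3 < 2 * n" "u = 2 * n - 3 \<longleftrightarrow> u + 3 = 2 * n"
      using special by linarith+
    ultimately show thesis using that(1-3) special by (metis evenE oddE)
  next
    case a
    then have "r = 2 * n" using r n by (simp add: div2_colour_def)
    with a show thesis by (rule that(4))
  next
    case a'
    then have "r = 2 * n" using r n by (simp add: div2_colour_def)
    with a' show thesis by (rule that(5))
  next
    case b
    then have "r = 2 * n + 1" using r n by (simp add: div2_colour_def)
    with b show thesis by (rule that(6))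
  next
    case reg
    have "v \<noteq> 2 * n + 1" "v \<noteq> 2 * n" "\<not> (v = u + 1 \<and> 2 \<le> u \<and> v \<le> 2 * n - 2)"
      "\<not> ((u, v) = (0, 2 * n - 2) \<or> (u, v) = (1, 2 * n - 3))" "(u, v) \<noteq> (0, 1)"
      using reg uv by auto
    then have eq: "r = div1_colour n u v"
      unfolding r div2_colour_def by (simp only: if_False)
    have bd: "1 \<le> r" "r < 2 * n" using div1_colour_bounds[OF uv(1,2)] by (simp_all add: eq)
    show thesis
    proof (cases "v + 1 = 2 * n")
      case True
      with bd show thesis using div1_colour_eq[OF uv(1,2) eq] by (intro that(7)) simp_all
    next
      case False
      then have "v + 1 < 2 * n" using uv(2) by linarith
      moreover have "2 * r = u + v + 3 \<or> 2 * r = u + v + 2 * n + 2 \<or> 2 * r + 2 * n = u + v + 4"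
        using False div1_colour_eq[OF uv(1,2) eq] by argo
      moreover have "\<not> (v = u + 1 \<and> 2 \<le> u)" using False reg(1) by argo
      ultimately show thesis using bd reg(2-4) that(8) by argo
    qed
  qed
qed

text \<open>In round \<open>r\<close>, at least 4, the upper end \<open>r - 1\<close> of the removed
  edge meets club \<open>2 * n + 1\<close>, hence the colour \<open>u + 1\<close>. The four clubs
  that are no upper end take the colours \<open>1\<close>, \<open>2\<close>, \<open>2 * n\<close>,
  \<open>2 * n + 1\<close>.\<close>

lemma div2_colour_last_cases:
  assumes u: "u < 2 * n" "3 \<le> n" and r: "r = div2_colour n u (2 * n + 1)"
  obtains (1) "u = 0" "r = 2" | (2) "u = 1" "r = 1" | (3) "u = 2" "r = 2 * n"
    | (4) "u + 1 = 2 * n" "r = 2 * n + 1" | (5) "3 \<le> u" "u + 1 < 2 * n" "r = u + 1"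
proof -
  obtain m where n: "n = m + 3" using u(2) by (metis add.commute le_Suc_ex)
  consider "u = 0" | "u = 1" | "u = 2" | "u + 1 = 2 * n" | "3 \<le> u" "u + 1 < 2 * n"
    using u by linarith
  then show thesis
    using r that n by cases (simp_all add: div2_colour_def)
qed

text \<open>Here it is the lower end \<open>r - 2\<close> of the removed edge, hence the colour
  \<open>u + 2\<close>.\<close>

lemma div2_colour_penultimate_cases:
  assumes u: "u < 2 * n" "3 \<le> n" and r: "r = div2_colour n u (2 * n)"
  obtains (1) "u = 0" "r = 1" | (2) "u = 1" "r = 2" | (3) "u + 2 = 2 * n" "r = 2 * n + 1"
    | (4) "u + 1 = 2 * n" "r = 2 * n" | (5) "2 \<le> u" "u + 2 < 2 * n" "r = u + 2"
proof -
  obtain m where n: "n = m + 3" using u(2) by (metis add.commute le_Suc_ex)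
  consider "u = 0" | "u = 1" | "u + 2 = 2 * n" | "u + 1 = 2 * n" | "2 \<le> u" "u + 2 < 2 * n"
    using u by linarith
  then show thesis
    using r that n by cases (simp_all add: div2_colour_def)
qed

section \<open>Properness of the division-two colouring\<close>

lemma div2_colour_range:
  assumes u: "u < v" "v < 2 * n + 2" and n: "3 \<le> n"
  shows "div2_colour n u v \<in> {1..2 * n + 2 - 1}"
proof -
  obtain r where r: "r = div2_colour n u v" by blast
  consider "v < 2 * n" | "u < 2 * n" "v = 2 * n" | "u < 2 * n" "v = 2 * n + 1"
    | "u = 2 * n" "v = 2 * n + 1" using u by linarith
  then have "1 \<le> r \<and> r \<le> 2 * n + 1"
  proof cases
    case 1
    show ?thesis by (rule div2_colour_cases[OF u(1) 1 n r]) (use n in auto)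
  next
    case 2
    show ?thesis by (rule div2_colour_penultimate_cases[OF 2(1) n r[unfolded 2]]) (use n in auto)
  next
    case 3
    show ?thesis by (rule div2_colour_last_cases[OF 3(1) n r[unfolded 3]]) (use n in auto)
  next
    case 4
    then show ?thesis using r n by (simp add: div2_colour_def)
  qed
  then show ?thesis using r by simp
qed

text \<open>In division one, the edge of colour \<open>u + 1\<close> at \<open>u\<close> is the
  cycle edge \<open>{u - 1, u}\<close>. It has been recoloured, which frees the colour for the match
  against \<open>2 * n + 1\<close>; likewise \<open>{u, u + 1}\<close> frees \<open>u + 2\<close>
  for the match against \<open>2 * n\<close>.\<close>

lemma div2_colour_distinct_last:
  assumes l: "u < v" "v < 2 * n" and n: "3 \<le> n"
  shows "distinct [div2_colour n u v, div2_colour n u (2 * n + 1), div2_colour n v (2 * n + 1)]"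
proof -
  obtain a b c where eq: "a = div2_colour n u v" "b = div2_colour n u (2 * n + 1)"
    "c = div2_colour n v (2 * n + 1)" by blast
  have l': "u < 2 * n" using l by auto
  note a = div2_colour_cases[OF l n eq(1)]
    and b = div2_colour_last_cases[OF l' n eq(2)]
    and c = div2_colour_last_cases[OF l(2) n eq(3)]
  have "a \<noteq> b"
  proof
    assume "a = b"
    with n l show False by (rule_tac a; rule_tac b; (elim disjE)?; (linarith | presburger))
  qed
  moreover have "a \<noteq> c"
  proof
    assume "a = c"
    with n l show False by (rule_tac a; rule_tac c; (elim disjE)?; (linarith | presburger))
  qed
  moreover have "b \<noteq> c"
  proof
    assume "b = c"
    with n l show False by (rule_tac b; rule_tac c; linarith)
  qed
  ultimately show ?thesis by (simp add: eq)
qed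

lemma div2_colour_distinct_penultimate:
  assumes l: "u < v" "v < 2 * n" and n: "3 \<le> n"
  shows "distinct [div2_colour n u v, div2_colour n u (2 * n), div2_colour n v (2 * n)]"
proof -
  obtain a b c where eq: "a = div2_colour n u v" "b = div2_colour n u (2 * n)"
    "c = div2_colour n v (2 * n)" by blast
  have l': "u < 2 * n" using l by auto
  note a = div2_colour_cases[OF l n eq(1)]
    and b = div2_colour_penultimate_cases[OF l' n eq(2)]
    and c = div2_colour_penultimate_cases[OF l(2) n eq(3)]
  have "a \<noteq> b"
  proof
    assume "a = b"
    with n l show False by (rule_tac a; rule_tac b; (elim disjE)?; (linarith | presburger))
  qed
  moreover have "a \<noteq> c"
  proof
    assume "a = c"
    with n l show False by (rule_tac a; rule_tac c; (elim disjE)?; (linarith | presburger))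
  qed
  moreover have "b \<noteq> c"
  proof
    assume "b = c"
    with n l show False by (rule_tac b; rule_tac c; linarith)
  qed
  ultimately show ?thesis by (simp add: eq)
qed

text \<open>The colours \<open>u + 1\<close> and \<open>u + 2\<close> start at 4 for either new
  club, so 3 is free for their own match.\<close>

lemma div2_colour_distinct_penultimate_last:
  assumes l: "u < 2 * n" and n: "3 \<le> n"
  shows "distinct [div2_colour n u (2 * n), div2_colour n u (2 * n + 1), div2_colour n (2 * n) (2 * n + 1)]"
proof -
  obtain a b where eq: "a = div2_colour n u (2 * n)" "b = div2_colour n u (2 * n + 1)"
    by blast
  note a = div2_colour_penultimate_cases[OF l n eq(1)] and b = div2_colour_last_cases[OF l n eq(2)]
  have c: "div2_colour n (2 * n) (2 * n + 1) = 3" using n by (simp add: div2_colour_def)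
  have "a \<noteq> b"
  proof
    assume "a = b"
    with n l show False by (rule_tac a; rule_tac b; linarith)
  qed
  moreover have "a \<noteq> 3" using n by (rule_tac a; linarith)
  moreover have "b \<noteq> 3" using n by (rule_tac b; linarith)
  ultimately show ?thesis unfolding c eq[symmetric] by simp
qed

text \<open>Division one never uses \<open>2 * n\<close> or \<open>2 * n + 1\<close>, and the edges
  given either colour are disjoint. The last path edge may take 1 because the round 1 matches of
  both its ends, \<open>{1, 2 * n - 3}\<close> and \<open>{0, 2 * n - 2}\<close>, have moved to
  \<open>2 * n\<close>.\<close>

lemma div2_colour_distinct:
  assumes l: "u < v" "v < w" "w < 2 * n" and n: "3 \<le> n"
  shows "distinct [div2_colour n u v, div2_colour n u w, div2_colour n v w]"
proof -
  obtain a b c where eq: "a = div2_colour n u v" "b = div2_colour n u w" "c = div2_colour n v w"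
    by blast
  have l': "u < w" "v < 2 * n" using l by auto
  note a = div2_colour_cases[OF l(1) l'(2) n eq(1)]
    and b = div2_colour_cases[OF l'(1) l(3) n eq(2)]
    and c = div2_colour_cases[OF l(2,3) n eq(3)]
  have "a \<noteq> b"
  proof
    assume "a = b"
    with n l l' show False
      by (rule_tac a; rule_tac b; (elim disjE)?; (linarith | presburger))
  qed
  moreover have "a \<noteq> c"
  proof
    assume "a = c"
    with n l l' show False by (rule_tac a; rule_tac c; (elim disjE)?; (linarith | presburger))
  qed
  moreover have "b \<noteq> c"
  proof
    assume "b = c"
    with n l l' show False by (rule_tac b; rule_tac c; (elim disjE)?; (linarith | presburger))
  qed
  ultimately show ?thesis by (simp add: eq)
qed

subsection \<open>Attaining the maximum\<close>

definition balanced_maximum :: "nat \<Rightarrow> bool" where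
  "balanced_maximum n \<longleftrightarrow> (\<exists>c1 c2 H1 H2. draw n c1 c2 \<and>
         orientation (2 * n) H1 \<and> orientation (2 * n + 2) H2 \<and>
         card (home_common_fixtures n c1 c2 H1 H2) = claimed_max n \<and>
         balanced (2 * n + 2) H2 \<and> balanced (2 * n) H1 \<and> balanced (2 * n) (H1\<inverse>))"

text \<open>\<open>S\<close> holds the matches given up, \<open>R\<close> the matches whose home
  side division two reverses; among division-one clubs outside \<open>S\<close> these are the ones
  played \<open>2 * n - 1\<close> rounds later. A lower bound on the common fixtures suffices, since
  the general upper bound turns it into equality.\<close>

lemma balanced_maximumI:
  assumes n: "1 \<le> n" and draw: "draw n (edge_fun g1) (edge_fun g2)"
    and S: "finite S" "claimed_max n + card S \<le> (2 * n) choose 2"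
    and g: "\<And>u v. u < v \<Longrightarrow> v < 2 * n \<Longrightarrow> {u, v} \<notin> S \<Longrightarrow>
      g2 u v = (if (u, v) \<in> R \<or> (v, u) \<in> R then g1 u v + (2 * n - 1) else g1 u v)"
    and R: "R \<subseteq> orient (2 * n + 2) parity"
    and even: "\<And>x. even x \<Longrightarrow>
      card (R\<inverse> `` {x}) \<le> card (R `` {x}) \<and> card (R `` {x}) \<le> card (R\<inverse> `` {x}) + 1"
    and odd: "\<And>x. odd x \<Longrightarrow>
      card (R `` {x}) \<le> card (R\<inverse> `` {x}) \<and> card (R\<inverse> `` {x}) \<le> card (R `` {x}) + 1"
  shows "balanced_maximum n"
proof -
  let ?H1 = "orient (2 * n) parity" and ?H2 = "orient (2 * n + 2) (reverse R parity)"
  let ?F = "home_common_fixtures n (edge_fun g1) (edge_fun g2) ?H1 ?H2"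
  have sub: "complete_edges (2 * n) - S \<subseteq> ?F"
  proof
    fix e assume e: "e \<in> complete_edges (2 * n) - S"
    then obtain u v where uv: "e = {u, v}" "u < v" "v < 2 * n" by (blast elim: complete_edgesE)
    have "edge_fun g1 {u, v} \<in> {1..2 * n - 1}"
      using draw e uv(1) by (auto simp: draw_def dest: round_robin_range)
    then have "g1 u v \<in> {1..2 * n - 1}" using uv(2) by (simp add: edge_fun_less)
    moreover have "{u, v} \<notin> S" using e uv(1) by blast
    ultimately show "e \<in> ?F"
      unfolding uv(1) using g[OF uv(2,3)] uv(2,3)
      by (intro home_common_fixtures_orient) (auto simp: reverse_def split: if_splits)
  qed
  have "?F \<subseteq> complete_edges (2 * n)"
    by (auto simp: home_common_fixtures_def common_fixtures_def)
  then have fin: "finite ?F" using finite_complete_edges finite_subset by blast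
  have "claimed_max n \<le> card (complete_edges (2 * n)) - card S"
    using S(2) by (simp add: card_complete_edges)
  also have "\<dots> \<le> card (complete_edges (2 * n) - S)"
    by (rule diff_card_le_card_Diff[OF S(1)])
  also have "\<dots> \<le> card ?F" by (rule card_mono[OF fin sub])
  finally have "claimed_max n \<le> card ?F" .
  moreover have "card ?F \<le> card (common_fixtures n (edge_fun g1) (edge_fun g2))"
    by (intro card_mono home_common_fixtures_subset)
      (simp add: common_fixtures_def finite_complete_edges)
  ultimately have "card ?F = claimed_max n"
    using common_fixtures_le_claimed_max[OF n draw] by linarith
  moreover have "balanced (2 * n + 2) ?H2"
    using balanced_reverse_parity[of R "n + 1"] R even odd by simp
  ultimately show ?thesis
    unfolding balanced_maximum_def
    using draw orientation_orient balanced_parity balanced_converse[OF balanced_parity] by blast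
qed

lemma draw_edge_fun:
  assumes "\<And>u v. u < v \<Longrightarrow> v < 2 * n \<Longrightarrow> g1 u v \<in> {1..2 * n - 1}"
    and "\<And>u v w. u < v \<Longrightarrow> v < w \<Longrightarrow> w < 2 * n \<Longrightarrow> distinct [g1 u v, g1 u w, g1 v w]"
    and "\<And>u v. u < v \<Longrightarrow> v < 2 * n + 2 \<Longrightarrow> g2 u v \<in> {1..2 * n + 2 - 1}"
    and "\<And>u v w. u < v \<Longrightarrow> v < w \<Longrightarrow> w < 2 * n + 2 \<Longrightarrow> distinct [g2 u v, g2 u w, g2 v w]"
  shows "draw n (edge_fun g1) (edge_fun g2)"
  unfolding draw_def using round_robin_edge_fun[OF assms(1,2)] round_robin_edge_fun[OF assms(3,4)]
  by simp

section \<open>The cases of one and two clubs per half, \<open>n = 1\<close> and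
  \<open>n = 2\<close>\<close>

lemma balanced_maximum_1:
  assumes "n = 1"
  shows "balanced_maximum n"
proof -
  \<comment> \<open>Row \<open>v\<close> lists the colours of the matches \<open>{u, v}\<close> with
    \<open>u < v\<close>.\<close>
  let ?g = "\<lambda>u v. [[], [1], [2, 3], [3, 2, 1]] ! v ! u :: nat"
  have 1: "\<forall>v<2 * n + 2. \<forall>u<v. ?g u v \<in> {1..2 * n + 2 - 1}" unfolding assms by code_simp
  have 2: "\<forall>w<2 * n + 2. \<forall>v<w. \<forall>u<v. distinct [?g u v, ?g u w, ?g v w]"
    unfolding assms by code_simp
  have "draw n (edge_fun (\<lambda>u v. 1)) (edge_fun ?g)"
  proof (rule draw_edge_fun)
    show "?g u v \<in> {1..2 * n + 2 - 1}" if "u < v" "v < 2 * n + 2" for u v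
      by (rule 1[rule_format]; fact)
    show "distinct [?g u v, ?g u w, ?g v w]" if "u < v" "v < w" "w < 2 * n + 2" for u v w
      by (rule 2[rule_format]; fact)
  qed (use assms in auto)
  then show ?thesis
    by (rule balanced_maximumI[where S = "{}" and R = "{}", rotated])
      (use assms in \<open>auto simp: claimed_max_def less_Suc_eq numeral_2_eq_2\<close>)
qed

lemma balanced_maximum_2:
  assumes "n = 2"
  shows "balanced_maximum n"
proof -
  let ?g1 = "\<lambda>u v. [[], [2], [1, 3], [3, 1, 2]] ! v ! u :: nat"
  let ?g2 = "\<lambda>u v. [[], [5], [1, 3], [3, 4, 2], [4, 2, 5, 1], [2, 1, 4, 5, 3]] ! v ! u :: nat"
  \<comment> \<open>\<open>{0, 1}\<close> and \<open>{1, 3}\<close> are the moved matches. The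
    matches of the new clubs close \<open>(3, 1)\<close> to a directed cycle, so only
    \<open>(0, 1)\<close> shifts a home game, from an even club to an odd one.\<close>
  let ?R = "{(0, 1), (3, 1), (1, 4), (4, 5), (5, 3)} :: (nat \<times> nat) set"
  have 1: "\<forall>v<2 * n. \<forall>u<v. ?g1 u v \<in> {1..2 * n - 1}" unfolding assms by code_simp
  have 2: "\<forall>w<2 * n. \<forall>v<w. \<forall>u<v. distinct [?g1 u v, ?g1 u w, ?g1 v w]"
    unfolding assms by code_simp
  have 3: "\<forall>v<2 * n + 2. \<forall>u<v. ?g2 u v \<in> {1..2 * n + 2 - 1}" unfolding assms by code_simp
  have 4: "\<forall>w<2 * n + 2. \<forall>v<w. \<forall>u<v. distinct [?g2 u v, ?g2 u w, ?g2 v w]"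
    unfolding assms by code_simp
  have draw: "draw n (edge_fun ?g1) (edge_fun ?g2)"
  proof (rule draw_edge_fun)
    show "?g1 u v \<in> {1..2 * n - 1}" if "u < v" "v < 2 * n" for u v
      by (rule 1[rule_format]; fact)
    show "distinct [?g1 u v, ?g1 u w, ?g1 v w]" if "u < v" "v < w" "w < 2 * n" for u v w
      by (rule 2[rule_format]; fact)
    show "?g2 u v \<in> {1..2 * n + 2 - 1}" if "u < v" "v < 2 * n + 2" for u v
      by (rule 3[rule_format]; fact)
    show "distinct [?g2 u v, ?g2 u w, ?g2 v w]" if "u < v" "v < w" "w < 2 * n + 2" for u v w
      by (rule 4[rule_format]; fact)
  qed
  show ?thesis
  proof (rule balanced_maximumI[OF _ draw, where S = "{}" and R = ?R])
    show "?R \<subseteq> orient (2 * n + 2) parity"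
      using assms by (simp add: orient_def home_def parity_def)
    have R: "?R `` {x} = (if x = 0 then {1} else if x = 1 then {4} else if x = 3 then {1}
        else if x = 4 then {5} else if x = 5 then {3} else {})"
      "?R\<inverse> `` {x} = (if x = 1 then {0, 3} else if x = 4 then {1} else if x = 5 then {4}
        else if x = 3 then {5} else {})" for x
      by auto
    show "card (?R\<inverse> `` {x}) \<le> card (?R `` {x}) \<and> card (?R `` {x}) \<le> card (?R\<inverse> `` {x}) + 1" if "even x" for x
      unfolding R using that by auto
    show "card (?R `` {x}) \<le> card (?R\<inverse> `` {x}) \<and> card (?R\<inverse> `` {x}) \<le> card (?R `` {x}) + 1" if "odd x" for x
      unfolding R using that by (auto simp: odd_pos)
    show "?g2 u v = (if (u, v) \<in> ?R \<or> (v, u) \<in> ?R then ?g1 u v + (2 * n - 1) else ?g1 u v)"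
      if "u < v" "v < 2 * n" for u v
    proof -
      have "u = 0 \<or> u = 1 \<or> u = 2" "v = 1 \<or> v = 2 \<or> v = 3" using that assms by linarith+
      then show ?thesis using that(1) assms by (elim disjE) simp_all
    qed
  qed (use assms in \<open>auto simp: claimed_max_def choose_two\<close>)
qed

lemma draw_div_colour:
  assumes n: "3 \<le> n"
  shows "draw n (edge_fun (div1_colour n)) (edge_fun (div2_colour n))"
proof (rule draw_edge_fun)
  show "div1_colour n u v \<in> {1..2 * n - 1}" if "u < v" "v < 2 * n" for u v
    using div1_colour_bounds[OF that] by auto
  show "distinct [div2_colour n u v, div2_colour n u w, div2_colour n v w]"
    if l: "u < v" "v < w" "w < 2 * n + 2" for u v w
  proof -
    consider "w < 2 * n" | "v < 2 * n" "w = 2 * n" | "v < 2 * n" "w = 2 * n + 1"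
      | "v = 2 * n" "w = 2 * n + 1" using l by linarith
    then show ?thesis
    proof cases
      case 1
      show ?thesis by (rule div2_colour_distinct[OF l(1,2) 1 n])
    next
      case 2
      then show ?thesis using div2_colour_distinct_penultimate[OF l(1) 2(1) n] by simp
    next
      case 3
      then show ?thesis using div2_colour_distinct_last[OF l(1) 3(1) n] by simp
    next
      case 4
      then show ?thesis using div2_colour_distinct_penultimate_last[OF _ n, of u] l(1) by simp
    qed
  qed
qed (use div1_colour_distinct div2_colour_range n in blast)+

lemma balanced_maximum_ge_3:
  assumes n: "3 \<le> n"
  shows "balanced_maximum n"
proof -
  obtain m where m: "n = m + 3" using n by (metis add.commute le_Suc_ex)
  \<comment> \<open>The first three pairs are the moved matches. The path from
    \<open>2 * n - 2\<close> over 0 to 1 shifts one home game from an even club to an odd one; the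
    other pairs form a directed cycle through both new clubs, which changes no count.\<close>
  let ?R = "{(2 * m + 4, 0), (0, 1), (2 * m + 3, 1), (1, 2 * m + 6), (2 * m + 6, 2 * m + 7),
    (2 * m + 7, 2 * m + 3)} :: (nat \<times> nat) set"
  let ?S = "(\<lambda>u. {u, u + 1}) ` {2..<2 * n - 2}"
  show ?thesis
  proof (rule balanced_maximumI[OF _ draw_div_colour[OF n], where S = ?S and R = ?R])
    show "?R \<subseteq> orient (2 * n + 2) parity"
      by (simp add: m orient_def home_def parity_def)
    have R: "?R `` {x} = (if x = 0 then {1} else if x = 1 then {2 * m + 6}
        else if x = 2 * m + 3 then {1} else if x = 2 * m + 4 then {0}
        else if x = 2 * m + 6 then {2 * m + 7} else if x = 2 * m + 7 then {2 * m + 3} else {})"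
      "?R\<inverse> `` {x} = (if x = 0 then {2 * m + 4} else if x = 1 then {0, 2 * m + 3}
        else if x = 2 * m + 3 then {2 * m + 7} else if x = 2 * m + 6 then {1}
        else if x = 2 * m + 7 then {2 * m + 6} else {})" for x
      by (auto split: if_splits)
    show "card (?R\<inverse> `` {x}) \<le> card (?R `` {x}) \<and> card (?R `` {x}) \<le> card (?R\<inverse> `` {x}) + 1" if "even x" for x
      unfolding R using that by auto
    show "card (?R `` {x}) \<le> card (?R\<inverse> `` {x}) \<and> card (?R\<inverse> `` {x}) \<le> card (?R `` {x}) + 1" if "odd x" for x
      unfolding R using that by auto
    show "div2_colour n u v = (if (u, v) \<in> ?R \<or> (v, u) \<in> ?R then div1_colour n u v + (2 * n - 1)
        else div1_colour n u v)"
      if uv: "u < v" "v < 2 * n" "{u, v} \<notin> ?S" for u v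
    proof -
      consider "u = 0" "v = 2 * m + 4" | "u = 1" "v = 2 * m + 3" | "u = 0" "v = 1"
        | (reg) "\<not> (u = 0 \<and> v = 2 * m + 4)" "\<not> (u = 1 \<and> v = 2 * m + 3)" "\<not> (u = 0 \<and> v = 1)"
        by argo
      then show ?thesis
      proof cases
        case reg
        have "\<not> (v = u + 1 \<and> 2 \<le> u \<and> v \<le> 2 * n - 2)"
          using uv(3) by auto
        moreover have "v \<noteq> 2 * n + 1" "v \<noteq> 2 * n" using uv(2) by auto
        moreover have "\<not> ((u, v) = (0, 2 * n - 2) \<or> (u, v) = (1, 2 * n - 3))" "(u, v) \<noteq> (0, 1)"
          using reg by (simp_all add: m add.commute)
        ultimately have "div2_colour n u v = div1_colour n u v"
          unfolding div2_colour_def by (simp only: if_False)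
        moreover have "(u, v) \<notin> ?R" "(v, u) \<notin> ?R" using reg uv(1,2) by (auto simp: m)
        ultimately show ?thesis by (simp only: if_False simp_thms)
      qed (simp_all add: m div1_colour_def div2_colour_def)
    qed
    have "card ?S \<le> 2 * n - 4" by (rule order_trans[OF card_image_le]) auto
    \<comment> \<open>Everything except the \<open>2 * n - 4\<close> path edges is a common
      fixture.\<close>
    moreover have "claimed_max n + (2 * n - 4) = 2 * n choose 2"
      by (simp add: m claimed_max_def choose_two power2_eq_square algebra_simps)
    ultimately show "claimed_max n + card ?S \<le> 2 * n choose 2" by linarith
  qed (use n in auto)
qed

theorem theorem2p1:
  fixes n :: nat
  assumes "n \<ge> 1"
  shows "(\<forall>c1 c2. draw n c1 c2 \<longrightarrow> card (common_fixtures n c1 c2) \<le> claimed_max n) \<and>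
    (\<exists>c1 c2. draw n c1 c2 \<and> card (common_fixtures n c1 c2) = claimed_max n) \<and>
    (\<exists>c1 c2 H1 H2. draw n c1 c2 \<and>
       orientation (2 * n) H1 \<and> orientation (2 * n + 2) H2 \<and>
       card (home_common_fixtures n c1 c2 H1 H2) = claimed_max n \<and>
       balanced (2 * n + 2) H2 \<and> balanced (2 * n) H1 \<and> balanced (2 * n) (H1\<inverse>))"
proof (intro conjI)
  show "\<forall>c1 c2. draw n c1 c2 \<longrightarrow> card (common_fixtures n c1 c2) \<le> claimed_max n"
    using common_fixtures_le_claimed_max[OF assms] by blast
  consider "n = 1" | "n = 2" | "3 \<le> n" using assms by linarith
  then show "\<exists>c1 c2 H1 H2. draw n c1 c2 \<and>
       orientation (2 * n) H1 \<and> orientation (2 * n + 2) H2 \<and>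
       card (home_common_fixtures n c1 c2 H1 H2) = claimed_max n \<and>
       balanced (2 * n + 2) H2 \<and> balanced (2 * n) H1 \<and> balanced (2 * n) (H1\<inverse>)"
    using balanced_maximum_1 balanced_maximum_2 balanced_maximum_ge_3
    unfolding balanced_maximum_def by cases
  then obtain c1 c2 H1 H2 where d: "draw n c1 c2"
    and c: "card (home_common_fixtures n c1 c2 H1 H2) = claimed_max n" by blast
  \<comment> \<open>The same draw serves without home and away: its common fixtures are squeezed
    between the home-and-away count and the upper bound.\<close>
  have "card (home_common_fixtures n c1 c2 H1 H2) \<le> card (common_fixtures n c1 c2)"
    by (intro card_mono home_common_fixtures_subset)
      (simp add: common_fixtures_def finite_complete_edges)
  then have "card (common_fixtures n c1 c2) = claimed_max n"
    using c common_fixtures_le_claimed_max[OF assms d] by linarith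
  then show "\<exists>c1 c2. draw n c1 c2 \<and> card (common_fixtures n c1 c2) = claimed_max n"
    using d by blast
qed

end
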